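(* Fix $\alpha\in(0,1)$. (Direct statement) For any $A,\delta>0$ there exist $A',\delta'>0$ such that, for every $f\in C^1_{0,+}(\mathbb{R})$ and $x\in\mathbb{R}$: if $|\log f'(t)-\log f'(s)|\le A|t-s|^\alpha$ for all $s,t\in(x-\delta,x+\delta)$, then $f\in\mathsf{LocH\ddot{o}lObs}^{\alpha}(x,\delta',A')$. (Converse) For any $A',\delta'>0$ there exist $A'',\delta''>0$ such that, for every $f\in C^1_{0,+}(\mathbb{R})$ and $x\in\mathbb{R}$: if $f\in\mathsf{LocH\ddot{o}lObs}^{\alpha}(x,\delta',A')$, then $|\log f'(t)-\log f'(s)|\le A''|t-s|^\alpha$ for all $s,t\in(x-\delta'',x+\delta'')$.
   Context: $C^1_{0,+}(\mathbb{R})=\{f\in C^1(\mathbb{R}): f(0)=0,\ f'(0)=1,\ f'(t)>0\ \forall t\}$. For such $f$ and $s\ne t\in\mathbb{R}$, $\mathcal{O}(f;s,t)_0=\frac{\sqrt{f'(s)f'(t)}}{|f(t)-f(s)|}$. The set $\mathsf{LocH\ddot{o}lObs}^{\alpha}(x,\delta,A)$ consists of all $f\in C^1_{0,+}(\mathbb{R})$ such that $\left|\mathcal{O}(f;s,t)_0-\frac1{|t-s|}\right|\le A|t-s|^{\alpha-1}$ for all $s\neq t\in(x-\delta,x+\delta)$. *)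

theory Defs
  imports "HOL-Analysis.Analysis"
begin

definition C1_0_plus :: "(real \<Rightarrow> real) set" where
  "C1_0_plus = {f. f C1_differentiable_on UNIV \<and> f 0 = 0 \<and> deriv f 0 = 1 \<and> (\<forall>t. deriv f t > 0)}"

definition observable0 :: "(real \<Rightarrow> real) \<Rightarrow> real \<Rightarrow> real \<Rightarrow> real" where
  "observable0 f s t = sqrt (deriv f s * deriv f t) / \<bar>f t - f s\<bar>"

definition LocHolObs :: "real \<Rightarrow> real \<Rightarrow> real \<Rightarrow> real \<Rightarrow> (real \<Rightarrow> real) set" where
  "LocHolObs \<alpha> x \<delta> A =
    {f \<in> C1_0_plus. \<forall>s \<in> {x - \<delta><..<x + \<delta>}. \<forall>t \<in> {x - \<delta><..<x + \<delta>}. s \<noteq> t \<longrightarrow>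
       \<bar>observable0 f s t - 1 / \<bar>t - s\<bar>\<bar> \<le> A * \<bar>t - s\<bar> powr (\<alpha> - 1)}"

text \<open>For \<open>s = t\<close> the bound below reads \<open>0 \<le> 0\<close>, since \<open>0 powr \<alpha> = 0\<close>.\<close>

definition loc_Hol_log_deriv :: "real \<Rightarrow> real \<Rightarrow> real \<Rightarrow> real \<Rightarrow> (real \<Rightarrow> real) \<Rightarrow> bool" where
  "loc_Hol_log_deriv \<alpha> x \<delta> A f \<longleftrightarrow>
    (\<forall>s \<in> {x - \<delta><..<x + \<delta>}. \<forall>t \<in> {x - \<delta><..<x + \<delta>}.
       \<bar>ln (deriv f t) - ln (deriv f s)\<bar> \<le> A * \<bar>t - s\<bar> powr \<alpha>)"

end

theory Submission
  imports Defs
begin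

text \<open>
  Both directions compare the dimensionless quantity \<open>\<theta> = observable0 f s t * \<bar>t - s\<bar>\<close>, which is
  the geometric mean of \<open>f' s\<close> and \<open>f' t\<close> divided by the mean of \<open>f'\<close> over the interval between
  them, with the value 1 that it has for affine maps. Membership in \<open>LocHolObs\<close> says that
  \<open>\<bar>\<theta> - 1\<bar> \<le> A * \<bar>t - s\<bar> powr \<alpha>\<close>.

  Direct part. By the mean value theorem the mean of \<open>f'\<close> is a value \<open>f' \<xi>\<close>, so
  \<open>\<theta> = exp u\<close> with \<open>u = (ln (f' s) + ln (f' t)) / 2 - ln (f' \<xi>)\<close>, and the Hoelder
  bound on \<open>ln f'\<close> controls \<open>u\<close>.

  Converse. Put \<open>g = 1 / sqrt f'\<close>. The difference quotient of \<open>f\<close> over \<open>[s, t]\<close> equals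
  \<open>1 / (g s * g t * \<theta>)\<close>. If \<open>m\<close> is the midpoint, the difference quotient over \<open>[s, t]\<close> is the
  average of those over \<open>[s, m]\<close> and \<open>[m, t]\<close>; clearing denominators gives the exact relation of
  \<open>midpoint_identity\<close>, a perturbation of \<open>2 * g m = g t + g s\<close>. It has two consequences on an
  interval so short that \<open>\<theta>\<close> stays within \<open>1/2\<close> of 1. Since \<open>g\<close> is positive, it gives a Harnack
  inequality \<open>g t \<le> 6 * g m\<close>, hence two-sided bounds of \<open>g\<close> by \<open>g x\<close> near the
  centre \<open>x\<close>. It also bounds the second differences of \<open>g\<close> by a multiple of
  \<open>\<bar>t - s\<bar> powr \<alpha> * g x\<close>. For \<open>\<alpha> < 1\<close> a bounded function with such second differences is
  Hoelder continuous of exponent \<open>\<alpha>\<close> (\<open>Holder_of_second_differences\<close>). Since \<open>g / g x\<close> is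
  bounded below, its logarithm, which is \<open>- ln f' / 2\<close> up to a constant, is Hoelder as well. All
  constants depend only on \<open>\<alpha>\<close>, \<open>A'\<close> and \<open>\<delta>'\<close>, because the estimates are relative to \<open>g x\<close>.
\<close>

section \<open>Increasing differentiable functions and their observable\<close>

lemma C1_0_plus_DERIV:
  assumes "f \<in> C1_0_plus"
  shows "(f has_real_derivative deriv f t) (at t)"
proof -
  obtain D where "(f has_vector_derivative D t) (at t)"
    using assms by (auto simp: C1_0_plus_def C1_differentiable_on_def)
  then have "(f has_real_derivative D t) (at t)"
    by (simp add: has_real_derivative_iff_has_vector_derivative)
  then show ?thesis
    by (metis DERIV_imp_deriv)
qed

lemma C1_0_plus_deriv_pos: "f \<in> C1_0_plus \<Longrightarrow> deriv f t > 0"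
  by (simp add: C1_0_plus_def)

lemma C1_0_plus_strict_mono:
  assumes "f \<in> C1_0_plus" and "s < t"
  shows "f s < f t"
proof (rule DERIV_pos_imp_increasing[OF \<open>s < t\<close>])
  show "\<exists>y. (f has_real_derivative y) (at r) \<and> 0 < y" for r
    using C1_0_plus_DERIV[OF assms(1), of r] C1_0_plus_deriv_pos[OF assms(1), of r] by auto
qed

lemma C1_0_plus_mean_value:
  assumes "f \<in> C1_0_plus" and "s < t"
  obtains \<xi> where "s < \<xi>" "\<xi> < t" "f t - f s = deriv f \<xi> * (t - s)"
proof -
  obtain \<xi> where "s < \<xi>" "\<xi> < t" "f t - f s = (t - s) * deriv f \<xi>"
    using MVT2[OF \<open>s < t\<close>, of f "deriv f"] C1_0_plus_DERIV[OF assms(1)] by blast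
  then show ?thesis
    by (intro that) (simp_all add: mult.commute)
qed

lemma observable0_commute: "observable0 f s t = observable0 f t s"
  by (simp add: observable0_def mult.commute abs_minus_commute)

lemma LocHolObs_I:
  assumes "f \<in> C1_0_plus"
    and "\<And>s t. x - \<delta> < s \<Longrightarrow> s < t \<Longrightarrow> t < x + \<delta> \<Longrightarrow>
           \<bar>observable0 f s t * (t - s) - 1\<bar> \<le> A * (t - s) powr \<alpha>"
  shows "f \<in> LocHolObs \<alpha> x \<delta> A"
proof -
  have ordered: "\<bar>observable0 f s t - 1 / \<bar>t - s\<bar>\<bar> \<le> A * \<bar>t - s\<bar> powr (\<alpha> - 1)"
    if "x - \<delta> < s" "s < t" "t < x + \<delta>" for s t
  proof -
    have "\<bar>observable0 f s t - 1 / (t - s)\<bar> = \<bar>(observable0 f s t * (t - s) - 1) / (t - s)\<bar>"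
      using that(2) by (simp add: diff_divide_distrib)
    also have "\<dots> = \<bar>observable0 f s t * (t - s) - 1\<bar> / (t - s)"
      using that(2) by (simp only: abs_divide)
    also have "\<dots> \<le> A * (t - s) powr \<alpha> / (t - s)"
      using assms(2)[OF that] that(2) by (intro divide_right_mono) auto
    finally show ?thesis
      using that(2) by (simp add: powr_diff)
  qed
  then have "\<bar>observable0 f s t - 1 / \<bar>t - s\<bar>\<bar> \<le> A * \<bar>t - s\<bar> powr (\<alpha> - 1)"
    if "s \<in> {x - \<delta><..<x + \<delta>}" "t \<in> {x - \<delta><..<x + \<delta>}" "s \<noteq> t" for s t
    using that ordered[of s t] ordered[of t s]
    by (cases "s < t") (auto simp: observable0_commute[of f t s] abs_minus_commute[of t s])
  with assms(1) show ?thesis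
    by (simp add: LocHolObs_def)
qed

lemma LocHolObs_D:
  assumes "f \<in> LocHolObs \<alpha> x \<delta> A" and "x - \<delta> < s" "s < t" "t < x + \<delta>"
  shows "\<bar>observable0 f s t * (t - s) - 1\<bar> \<le> A * (t - s) powr \<alpha>"
proof -
  have "\<bar>observable0 f s t - 1 / (t - s)\<bar> \<le> A * (t - s) powr (\<alpha> - 1)"
  proof -
    have "\<forall>s \<in> {x - \<delta><..<x + \<delta>}. \<forall>t \<in> {x - \<delta><..<x + \<delta>}. s \<noteq> t \<longrightarrow>
        \<bar>observable0 f s t - 1 / \<bar>t - s\<bar>\<bar> \<le> A * \<bar>t - s\<bar> powr (\<alpha> - 1)"
      using assms(1) by (simp add: LocHolObs_def)
    from this[rule_format, of s t] show ?thesis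
      using assms(2-4) by simp
  qed
  then have "\<bar>observable0 f s t - 1 / (t - s)\<bar> * (t - s) \<le> A * (t - s) powr (\<alpha> - 1) * (t - s)"
    using assms(3) by (intro mult_right_mono) auto
  moreover have "\<bar>observable0 f s t - 1 / (t - s)\<bar> * (t - s) = \<bar>observable0 f s t * (t - s) - 1\<bar>"
    using assms(3) by (simp add: left_diff_distrib abs_mult_pos)
  ultimately show ?thesis
    using assms(3) by (simp add: powr_diff)
qed

section \<open>From log-derivative to observable\<close>

lemma abs_exp_minus_one_le:
  fixes u :: real
  assumes "\<bar>u\<bar> \<le> b"
  shows "\<bar>exp u - 1\<bar> \<le> b * exp b"
proof -
  have "exp u - 1 \<le> u * exp u"
    using mult_right_mono[OF exp_ge_add_one_self[of "- u"], of "exp u"]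
    by (simp add: algebra_simps exp_minus)
  also have "\<dots> \<le> b * exp b"
    using assms by (intro mult_mono) auto
  finally have "exp u - 1 \<le> b * exp b" .
  moreover have "1 - exp u \<le> b * exp b"
  proof -
    have "1 - exp u \<le> b * 1"
      using exp_ge_add_one_self[of u] assms by linarith
    also have "\<dots> \<le> b * exp b"
      using assms by (intro mult_left_mono) auto
    finally show ?thesis .
  qed
  ultimately show ?thesis by linarith
qed

lemma LocHolObs_of_loc_Hol_log_deriv:
  assumes f: "f \<in> C1_0_plus" and hol: "loc_Hol_log_deriv \<alpha> x \<delta> A f"
    and "0 < \<alpha>" "0 \<le> A"
  shows "f \<in> LocHolObs \<alpha> x \<delta> (A * exp (A * (2 * \<delta>) powr \<alpha>))"
proof (rule LocHolObs_I[OF f])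
  fix s t assume st: "x - \<delta> < s" "s < t" "t < x + \<delta>"
  define b where "b = A * (t - s) powr \<alpha>"
  obtain \<xi> where \<xi>: "s < \<xi>" "\<xi> < t" "f t - f s = deriv f \<xi> * (t - s)"
    using C1_0_plus_mean_value[OF f st(2)] by blast
  have osc: "\<bar>ln (deriv f r) - ln (deriv f \<xi>)\<bar> \<le> b" if "r = s \<or> r = t" for r
  proof -
    have "\<bar>ln (deriv f r) - ln (deriv f \<xi>)\<bar> \<le> A * \<bar>r - \<xi>\<bar> powr \<alpha>"
      using st \<xi> that
      by (intro hol[unfolded loc_Hol_log_deriv_def, rule_format]) auto
    also have "\<dots> \<le> b"
      unfolding b_def using that \<xi> assms(3,4) by (intro mult_left_mono powr_mono2) auto
    finally show ?thesis .
  qed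
  define u where "u = (ln (deriv f s) + ln (deriv f t)) / 2 - ln (deriv f \<xi>)"
  have u: "\<bar>u\<bar> \<le> b"
    using osc[of s] osc[of t] unfolding u_def by (simp add: abs_le_iff field_simps)
  have sqrt_eq: "sqrt (deriv f s * deriv f t) = exp ((ln (deriv f s) + ln (deriv f t)) / 2)"
  proof (rule real_sqrt_unique)
    have "(exp ((ln (deriv f s) + ln (deriv f t)) / 2))\<^sup>2 = exp (ln (deriv f s) + ln (deriv f t))"
      by (simp only: power2_eq_square exp_add[symmetric] field_sum_of_halves)
    also have "\<dots> = deriv f s * deriv f t"
      using C1_0_plus_deriv_pos[OF f] by (simp add: exp_add)
    finally show "(exp ((ln (deriv f s) + ln (deriv f t)) / 2))\<^sup>2 = deriv f s * deriv f t" .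
  qed simp
  have "observable0 f s t * (t - s) = sqrt (deriv f s * deriv f t) / deriv f \<xi>"
    using st(2) \<xi>(3) C1_0_plus_deriv_pos[OF f, of \<xi>]
    by (simp add: observable0_def abs_mult)
  also have "\<dots> = exp u"
    unfolding u_def exp_diff sqrt_eq using C1_0_plus_deriv_pos[OF f, of \<xi>] by simp
  finally have "\<bar>observable0 f s t * (t - s) - 1\<bar> \<le> b * exp b"
    using abs_exp_minus_one_le[OF u] by simp
  also have "\<dots> \<le> b * exp (A * (2 * \<delta>) powr \<alpha>)"
    unfolding b_def using st assms(3,4)
    by (intro mult_left_mono iffD2[OF exp_le_cancel_iff] powr_mono2) auto
  finally show "\<bar>observable0 f s t * (t - s) - 1\<bar>
      \<le> A * exp (A * (2 * \<delta>) powr \<alpha>) * (t - s) powr \<alpha>"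
    by (simp add: b_def mult_ac)
qed

section \<open>Second differences and Hoelder continuity\<close>

text \<open>
  With \<open>D h = g (s + h) - g s\<close>, a second difference is \<open>D (2 * h) - 2 * D h\<close>. So passing from
  scale \<open>2 * h\<close> to scale \<open>h\<close> halves the difference up to an error \<open>C * h powr \<alpha>\<close>, and a bound
  \<open>B * h powr \<alpha>\<close> reproduces itself as soon as \<open>B * 2 powr (\<alpha> - 1) + C \<le> B\<close>; this is where
  \<open>\<alpha> < 1\<close> enters. Starting from the crude bound by \<open>2 * M\<close> at scales comparable to \<open>R\<close>, induction
  over dyadic scales reaches every smaller \<open>h > 0\<close>.
  The points are kept within \<open>R / 3\<close> of \<open>x\<close>, so that \<open>h < 2 * R / 3\<close> and all increments
  taken from the left end point stay inside the interval of radius \<open>R\<close>.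
\<close>

lemma Holder_of_second_differences:
  fixes g :: "real \<Rightarrow> real"
  assumes \<alpha>: "0 < \<alpha>" "\<alpha> < 1" and pos: "0 < R" "0 \<le> M" "0 \<le> C"
    and bound: "\<And>s. s \<in> {x - R<..<x + R} \<Longrightarrow> \<bar>g s\<bar> \<le> M"
    and second: "\<And>s h. x - R < s \<Longrightarrow> 0 < h \<Longrightarrow> s + 2 * h < x + R \<Longrightarrow>
                   \<bar>g s + g (s + 2 * h) - 2 * g (s + h)\<bar> \<le> C * h powr \<alpha>"
    and st: "s \<in> {x - R / 3<..<x + R / 3}" "t \<in> {x - R / 3<..<x + R / 3}"
  shows "\<bar>g t - g s\<bar> \<le> (2 * M / (R / 3) powr \<alpha> + C / (1 - 2 powr (\<alpha> - 1))) * \<bar>t - s\<bar> powr \<alpha>"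
proof -
  define q :: real where "q = 2 powr (\<alpha> - 1)"
  define B where "B = 2 * M / (R / 3) powr \<alpha> + C / (1 - q)"
  have q: "0 < q" "q < 1"
    unfolding q_def using \<alpha> powr_less_mono[of "\<alpha> - 1" 0 2] by auto
  have "0 \<le> 2 * M / (R / 3) powr \<alpha>" "0 \<le> C / (1 - q)"
    using q pos by auto
  then have B: "2 * M / (R / 3) powr \<alpha> \<le> B" "C / (1 - q) \<le> B" "0 \<le> B"
    unfolding B_def by auto
  from B(2) q have step_B: "B * q + C \<le> B"
    by (simp add: field_simps)
  have dyadic: "\<bar>g (s + h) - g s\<bar> \<le> B * h powr \<alpha>"
    if s: "s \<in> {x - R / 3<..<x + R / 3}" and "R / 3 \<le> 2 ^ n * h" "0 < h" "h < 2 * R / 3" for s h n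
    using that(2-)
  proof (induction n arbitrary: h)
    case 0
    have "\<bar>g (s + h) - g s\<bar> \<le> \<bar>g (s + h)\<bar> + \<bar>g s\<bar>"
      by linarith
    also have "\<dots> \<le> M + M"
      using s 0 pos(1) by (intro add_mono bound) auto
    also have "\<dots> = 2 * M / (R / 3) powr \<alpha> * (R / 3) powr \<alpha>"
      using pos(1) by simp
    also have "\<dots> \<le> B * h powr \<alpha>"
      using B 0 pos(1) \<alpha> by (intro mult_mono powr_mono2) auto
    finally show ?case .
  next
    case (Suc n)
    show ?case
    proof (cases "R / 3 \<le> h")
      case True
      have "1 * h \<le> 2 ^ n * h"
        using Suc.prems by (intro mult_right_mono) auto
      with True have "R / 3 \<le> 2 ^ n * h"
        by linarith
      then show ?thesis
        using Suc.IH Suc.prems by blast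
    next
      case False
      have "\<bar>g (s + 2 * h) - g s\<bar> \<le> B * (2 * h) powr \<alpha>"
        using Suc.prems False by (intro Suc.IH) (auto simp: mult_ac)
      also have "\<dots> = 2 * (B * q * h powr \<alpha>)"
        using Suc.prems by (simp add: q_def powr_mult powr_diff)
      finally have double: "\<bar>g (s + 2 * h) - g s\<bar> \<le> 2 * (B * q * h powr \<alpha>)" .
      have "\<bar>g s + g (s + 2 * h) - 2 * g (s + h)\<bar> \<le> C * h powr \<alpha>"
        using s Suc.prems False by (intro second) auto
      moreover have "0 \<le> C * h powr \<alpha>"
        using pos by simp
      ultimately have "\<bar>g (s + h) - g s\<bar> \<le> B * q * h powr \<alpha> + C * h powr \<alpha>"
        using double by linarith
      also have "\<dots> = (B * q + C) * h powr \<alpha>"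
        by (simp add: algebra_simps)
      also have "\<dots> \<le> B * h powr \<alpha>"
        using step_B by (intro mult_right_mono) auto
      finally show ?thesis .
    qed
  qed
  have ordered: "\<bar>g t - g s\<bar> \<le> B * (t - s) powr \<alpha>"
    if "s \<in> {x - R / 3<..<x + R / 3}" "t \<in> {x - R / 3<..<x + R / 3}" "s < t" for s t
  proof -
    obtain n where n: "R / 3 / (t - s) < 2 ^ n"
      using real_arch_pow[of 2 "R / 3 / (t - s)"] by auto
    have "0 < t - s"
      using that(3) by simp
    with n have "R / 3 \<le> 2 ^ n * (t - s)"
      by (simp only: pos_divide_less_eq less_imp_le)
    with dyadic[OF that(1), of n "t - s"] that show ?thesis
      by auto
  qed
  have "\<bar>g t - g s\<bar> \<le> B * \<bar>t - s\<bar> powr \<alpha>"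
    using ordered[OF st] ordered[OF st(2,1)]
    by (cases s t rule: linorder_cases) (auto simp: abs_minus_commute)
  then show ?thesis
    by (simp add: B_def q_def)
qed

section \<open>From observable to log-derivative\<close>

definition inv_sqrt_deriv :: "(real \<Rightarrow> real) \<Rightarrow> real \<Rightarrow> real" where
  "inv_sqrt_deriv f t = 1 / sqrt (deriv f t)"

lemma inv_sqrt_deriv_pos: "f \<in> C1_0_plus \<Longrightarrow> inv_sqrt_deriv f t > 0"
  by (simp add: inv_sqrt_deriv_def C1_0_plus_deriv_pos)

lemma ln_deriv_eq:
  assumes "f \<in> C1_0_plus"
  shows "ln (deriv f t) = - 2 * ln (inv_sqrt_deriv f t)"
  using C1_0_plus_deriv_pos[OF assms, of t] by (simp add: inv_sqrt_deriv_def ln_div ln_sqrt)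

lemma increment_eq:
  assumes f: "f \<in> C1_0_plus" and "s < t"
  shows "f t - f s = 1 / (inv_sqrt_deriv f s * inv_sqrt_deriv f t * observable0 f s t)"
  using C1_0_plus_strict_mono[OF assms] C1_0_plus_deriv_pos[OF f, of s] C1_0_plus_deriv_pos[OF f, of t]
  by (simp add: observable0_def inv_sqrt_deriv_def real_sqrt_mult)

text \<open>
  The reason is additivity of the increments of \<open>f\<close> over \<open>[s, s + h]\<close> and \<open>[s + h, s + 2 * h]\<close>, with
  each increment expressed by \<open>increment_eq\<close>.
\<close>

lemma midpoint_identity:
  assumes f: "f \<in> C1_0_plus" and "0 < h"
  shows "2 * inv_sqrt_deriv f (s + h) / (observable0 f s (s + 2 * h) * (2 * h))
       = inv_sqrt_deriv f (s + 2 * h) / (observable0 f s (s + h) * h)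
         + inv_sqrt_deriv f s / (observable0 f (s + h) (s + 2 * h) * h)"
proof -
  define a m b where "a = inv_sqrt_deriv f s" and "m = inv_sqrt_deriv f (s + h)"
    and "b = inv_sqrt_deriv f (s + 2 * h)"
  define w u v where "w = observable0 f s (s + 2 * h)" and "u = observable0 f s (s + h)"
    and "v = observable0 f (s + h) (s + 2 * h)"
  have pos: "a > 0" "m > 0" "b > 0"
    by (auto simp: a_def m_def b_def inv_sqrt_deriv_pos[OF f])
  have "1 / (a * b * w) = 1 / (a * m * u) + 1 / (m * b * v)"
    using increment_eq[OF f, of s "s + 2 * h"] increment_eq[OF f, of s "s + h"]
      increment_eq[OF f, of "s + h" "s + 2 * h"] assms(2)
    by (simp add: a_def m_def b_def w_def u_def v_def)
  then have "a * m * b * (1 / (a * b * w)) / h = a * m * b * (1 / (a * m * u) + 1 / (m * b * v)) / h"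
    by simp
  then have "m / w / h = b / u / h + a / v / h"
    using pos by (simp add: distrib_left add_divide_distrib)
  then show ?thesis
    by (simp add: a_def m_def b_def w_def u_def v_def)
qed

lemma abs_inverse_minus_one_le:
  fixes \<theta> :: real
  assumes "\<bar>\<theta> - 1\<bar> \<le> \<epsilon>" and "\<epsilon> \<le> 1 / 2"
  shows "\<bar>1 / \<theta> - 1\<bar> \<le> 2 * \<epsilon>" and "2 / 3 \<le> 1 / \<theta>"
proof -
  have \<theta>: "1 / 2 \<le> \<theta>" "\<theta> \<le> 3 / 2"
    using assms by auto
  have "\<bar>1 / \<theta> - 1\<bar> = \<bar>(\<theta> - 1) / \<theta>\<bar>"
    using \<theta> by (simp add: diff_divide_distrib abs_minus_commute)
  also have "\<dots> = \<bar>\<theta> - 1\<bar> / \<theta>"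
    using \<theta> by (simp only: abs_divide)
  also have "\<dots> \<le> \<epsilon> / (1 / 2)"
    using assms \<theta> by (intro frac_le) auto
  finally show "\<bar>1 / \<theta> - 1\<bar> \<le> 2 * \<epsilon>" by simp
  show "2 / 3 \<le> 1 / \<theta>"
    using \<theta> by (simp add: field_simps)
qed

text \<open>
  The weights \<open>1 / \<theta>\<close> in \<open>midpoint_identity\<close> lie in \<open>[2/3, 2]\<close>, so dropping the positive term with
  \<open>g s\<close> gives \<open>2/3 * g t \<le> 4 * g m\<close>; the roles of the two end points are symmetric.
\<close>

lemma midpoint_estimates:
  fixes f h s
  defines "g \<equiv> inv_sqrt_deriv f"
  assumes f: "f \<in> LocHolObs \<alpha> x \<rho> A" and \<alpha>: "0 < \<alpha>" and A: "0 < A"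
    and small: "A * (2 * \<rho>) powr \<alpha> \<le> 1 / 2"
    and h: "0 < h" "x - \<rho> < s" "s + 2 * h < x + \<rho>"
  shows "g s \<le> 6 * g (s + h)" and "g (s + 2 * h) \<le> 6 * g (s + h)"
    and "\<bar>g s + g (s + 2 * h) - 2 * g (s + h)\<bar> \<le> 28 * (A * (2 * h) powr \<alpha>) * g (s + h)"
proof -
  have f': "f \<in> C1_0_plus"
    using f by (simp add: LocHolObs_def)
  have g_pos: "g r > 0" for r
    unfolding g_def using inv_sqrt_deriv_pos[OF f'] .
  define \<epsilon> where "\<epsilon> = A * (2 * h) powr \<alpha>"
  have "\<epsilon> \<le> A * (2 * \<rho>) powr \<alpha>"
    unfolding \<epsilon>_def using h \<alpha> A by (intro mult_left_mono powr_mono2) auto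
  with small have "\<epsilon> \<le> 1 / 2"
    by linarith
  moreover have "0 < \<epsilon>"
    using h(1) A by (simp add: \<epsilon>_def)
  ultimately have \<epsilon>: "0 < \<epsilon>" "\<epsilon> \<le> 1 / 2"
    by auto
  define W U V where "W = 1 / (observable0 f s (s + 2 * h) * (2 * h))"
    and "U = 1 / (observable0 f s (s + h) * h)"
    and "V = 1 / (observable0 f (s + h) (s + 2 * h) * h)"
  have theta: "\<bar>observable0 f p r * (r - p) - 1\<bar> \<le> \<epsilon>"
    if "s \<le> p" "p < r" "r \<le> s + 2 * h" for p r
  proof -
    have "\<bar>observable0 f p r * (r - p) - 1\<bar> \<le> A * (r - p) powr \<alpha>"
      using that h by (intro LocHolObs_D[OF f]) auto
    also have "\<dots> \<le> \<epsilon>"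
      unfolding \<epsilon>_def using that \<alpha> A by (intro mult_left_mono powr_mono2) auto
    finally show ?thesis .
  qed
  have th: "\<bar>observable0 f s (s + 2 * h) * (2 * h) - 1\<bar> \<le> \<epsilon>"
    "\<bar>observable0 f s (s + h) * h - 1\<bar> \<le> \<epsilon>"
    "\<bar>observable0 f (s + h) (s + 2 * h) * h - 1\<bar> \<le> \<epsilon>"
    using theta[of s "s + 2 * h"] theta[of s "s + h"] theta[of "s + h" "s + 2 * h"] h(1) by simp_all
  have W: "\<bar>W - 1\<bar> \<le> 2 * \<epsilon>"
    unfolding W_def by (rule abs_inverse_minus_one_le[OF th(1) \<epsilon>(2)])
  have U: "\<bar>U - 1\<bar> \<le> 2 * \<epsilon>" "2 / 3 \<le> U"
    unfolding U_def by (rule abs_inverse_minus_one_le[OF th(2) \<epsilon>(2)])+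
  have V: "\<bar>V - 1\<bar> \<le> 2 * \<epsilon>" "2 / 3 \<le> V"
    unfolding V_def by (rule abs_inverse_minus_one_le[OF th(3) \<epsilon>(2)])+
  have id: "2 * g (s + h) * W = g (s + 2 * h) * U + g s * V"
    using midpoint_identity[OF f' h(1), of s] by (simp add: W_def U_def V_def g_def)
  have "2 * g (s + h) * W \<le> 2 * g (s + h) * 2"
    using W \<epsilon>(2) g_pos[of "s + h"] by (intro mult_left_mono) auto
  moreover have lower: "g (s + 2 * h) * (2 / 3) \<le> g (s + 2 * h) * U" "g s * (2 / 3) \<le> g s * V"
    using U(2) V(2) g_pos[of s] g_pos[of "s + 2 * h"] by (auto intro: mult_left_mono)
  ultimately show harnack: "g s \<le> 6 * g (s + h)" "g (s + 2 * h) \<le> 6 * g (s + h)"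
    using id g_pos[of s] g_pos[of "s + 2 * h"] by linarith+
  have "g s + g (s + 2 * h) - 2 * g (s + h)
      = 2 * g (s + h) * (W - 1) - g (s + 2 * h) * (U - 1) - g s * (V - 1)"
    using id by (simp add: algebra_simps)
  also have "\<bar>\<dots>\<bar> \<le> \<bar>2 * g (s + h) * (W - 1)\<bar> + \<bar>g (s + 2 * h) * (U - 1)\<bar> + \<bar>g s * (V - 1)\<bar>"
    by linarith
  also have "\<dots> = 2 * g (s + h) * \<bar>W - 1\<bar> + g (s + 2 * h) * \<bar>U - 1\<bar> + g s * \<bar>V - 1\<bar>"
    using g_pos by (simp add: abs_mult abs_of_pos)
  also have "\<dots> \<le> 2 * g (s + h) * (2 * \<epsilon>) + 6 * g (s + h) * (2 * \<epsilon>) + 6 * g (s + h) * (2 * \<epsilon>)"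
    using W U V harnack g_pos[of s] g_pos[of "s + h"] g_pos[of "s + 2 * h"] \<epsilon>(1)
    by (intro add_mono mult_mono) auto
  finally show "\<bar>g s + g (s + 2 * h) - 2 * g (s + h)\<bar> \<le> 28 * (A * (2 * h) powr \<alpha>) * g (s + h)"
    by (simp add: \<epsilon>_def mult_ac)
qed

lemma abs_ln_diff_le:
  fixes a b c :: real
  assumes "0 < c" "c \<le> a" "c \<le> b"
  shows "\<bar>ln a - ln b\<bar> \<le> \<bar>a - b\<bar> / c"
proof -
  have *: "ln p - ln r \<le> \<bar>p - r\<bar> / c" if "c \<le> p" "c \<le> r" for p r
  proof -
    have "ln p - ln r \<le> (p - r) / r"
      using ln_diff_le[of p r] assms(1) that by simp
    also have "\<dots> \<le> \<bar>p - r\<bar> / c"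
      using assms(1) that by (intro frac_le) auto
    finally show ?thesis .
  qed
  show ?thesis
    using *[OF assms(2,3)] *[OF assms(3,2)] by (simp add: abs_le_iff abs_minus_commute)
qed

text \<open>
  The Harnack inequality is used twice: with midpoint \<open>x\<close> it bounds \<open>g\<close> above by \<open>6 * g x\<close> on
  the whole interval, and with midpoint \<open>r\<close> and end point \<open>x\<close> it bounds \<open>g r\<close> below by \<open>g x / 6\<close>;
  the latter requires the reflection \<open>2 * r - x\<close> to stay in the interval, which holds in its
  middle half.
\<close>

lemma loc_Hol_log_deriv_of_LocHolObs:
  assumes f: "f \<in> LocHolObs \<alpha> x \<rho> A" and \<alpha>: "0 < \<alpha>" "\<alpha> < 1" and A: "0 < A" and \<rho>: "0 < \<rho>"
    and small: "A * (2 * \<rho>) powr \<alpha> \<le> 1 / 2"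
  shows "loc_Hol_log_deriv \<alpha> x (\<rho> / 3)
    (12 * (12 / (\<rho> / 3) powr \<alpha> + 168 * A * 2 powr \<alpha> / (1 - 2 powr (\<alpha> - 1)))) f"
proof -
  have f': "f \<in> C1_0_plus"
    using f by (simp add: LocHolObs_def)
  define g where "g = inv_sqrt_deriv f"
  define w where "w r = g r / g x" for r
  have g_pos: "g r > 0" for r
    unfolding g_def using inv_sqrt_deriv_pos[OF f'] .
  have w_pos: "w r > 0" for r
    by (simp add: w_def g_pos)
  note est = midpoint_estimates[OF f \<alpha>(1) A small, folded g_def]
  have upper: "w r \<le> 6" if r: "r \<in> {x - \<rho><..<x + \<rho>}" for r
  proof -
    consider "r < x" | "r = x" | "x < r" by linarith
    then have "g r \<le> 6 * g x"
    proof cases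
      case 1
      then show ?thesis using est(1)[of "x - r" r] r by (simp add: algebra_simps)
    next
      case 2
      then show ?thesis using g_pos[of x] by simp
    next
      case 3
      then show ?thesis using est(2)[of "r - x" "2 * x - r"] r by (simp add: algebra_simps)
    qed
    then show ?thesis using g_pos[of x] by (simp add: w_def divide_le_eq)
  qed
  have lower: "1 / 6 \<le> w r" if r: "r \<in> {x - \<rho> / 3<..<x + \<rho> / 3}" for r
  proof -
    consider "r < x" | "r = x" | "x < r" by linarith
    then have "g x \<le> 6 * g r"
    proof cases
      case 1
      then show ?thesis using est(2)[of "x - r" "2 * r - x"] r \<rho> by (simp add: algebra_simps)
    next
      case 2
      then show ?thesis using g_pos[of x] by simp
    next
      case 3
      then show ?thesis using est(1)[of "r - x" x] r \<rho> by (simp add: algebra_simps)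
    qed
    then show ?thesis using g_pos[of x] by (simp add: w_def le_divide_eq)
  qed
  have second: "\<bar>w s + w (s + 2 * h) - 2 * w (s + h)\<bar> \<le> 168 * A * 2 powr \<alpha> * h powr \<alpha>"
    if h: "x - \<rho> < s" "0 < h" "s + 2 * h < x + \<rho>" for s h
  proof -
    have "w s + w (s + 2 * h) - 2 * w (s + h) = (g s + g (s + 2 * h) - 2 * g (s + h)) / g x"
      by (simp add: w_def diff_divide_distrib add_divide_distrib)
    then have "\<bar>w s + w (s + 2 * h) - 2 * w (s + h)\<bar> = \<bar>g s + g (s + 2 * h) - 2 * g (s + h)\<bar> / g x"
      using g_pos[of x] by (simp add: abs_divide)
    also have "\<dots> \<le> 28 * (A * (2 * h) powr \<alpha>) * g (s + h) / g x"
      using est(3)[OF h(2,1,3)] g_pos[of x] by (intro divide_right_mono) auto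
    also have "\<dots> = 28 * (A * (2 * h) powr \<alpha>) * w (s + h)"
      by (simp add: w_def)
    also have "\<dots> \<le> 28 * (A * (2 * h) powr \<alpha>) * 6"
      using upper[of "s + h"] h A by (intro mult_left_mono) auto
    also have "\<dots> = 168 * A * 2 powr \<alpha> * h powr \<alpha>"
      using h(2) by (simp add: powr_mult)
    finally show ?thesis .
  qed
  define B where "B = 12 / (\<rho> / 3) powr \<alpha> + 168 * A * 2 powr \<alpha> / (1 - 2 powr (\<alpha> - 1))"
  have "loc_Hol_log_deriv \<alpha> x (\<rho> / 3) (12 * B) f"
    unfolding loc_Hol_log_deriv_def
  proof (intro ballI)
    fix s t assume st: "s \<in> {x - \<rho> / 3<..<x + \<rho> / 3}" "t \<in> {x - \<rho> / 3<..<x + \<rho> / 3}"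
    have "\<bar>w t - w s\<bar> \<le> (2 * 6 / (\<rho> / 3) powr \<alpha>
        + 168 * A * 2 powr \<alpha> / (1 - 2 powr (\<alpha> - 1))) * \<bar>t - s\<bar> powr \<alpha>"
      using upper w_pos A
      by (intro Holder_of_second_differences[OF \<alpha> \<rho> _ _ _ second st]) (auto simp: abs_of_pos)
    then have holder: "\<bar>w t - w s\<bar> \<le> B * \<bar>t - s\<bar> powr \<alpha>"
      by (simp add: B_def)
    have ln_eq: "ln (deriv f r) = - 2 * (ln (w r) + ln (g x))" for r
      using ln_deriv_eq[OF f', of r] g_pos[of r] g_pos[of x] by (simp add: w_def ln_div g_def)
    have "\<bar>ln (deriv f t) - ln (deriv f s)\<bar> = 2 * \<bar>ln (w t) - ln (w s)\<bar>"
      unfolding ln_eq by (simp add: abs_if)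
    also have "\<dots> \<le> 2 * (\<bar>w t - w s\<bar> / (1 / 6))"
      using lower[OF st(1)] lower[OF st(2)] by (intro mult_left_mono abs_ln_diff_le) auto
    also have "\<dots> = 12 * \<bar>w t - w s\<bar>"
      by simp
    also have "\<dots> \<le> 12 * (B * \<bar>t - s\<bar> powr \<alpha>)"
      using holder by simp
    finally show "\<bar>ln (deriv f t) - ln (deriv f s)\<bar> \<le> 12 * B * \<bar>t - s\<bar> powr \<alpha>"
      by simp
  qed
  then show ?thesis
    by (simp only: B_def)
qed

lemma LocHolObs_mono_radius:
  "\<rho> \<le> \<delta> \<Longrightarrow> f \<in> LocHolObs \<alpha> x \<delta> A \<Longrightarrow> f \<in> LocHolObs \<alpha> x \<rho> A"
  by (auto simp: LocHolObs_def)

theorem theorem6: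
  fixes \<alpha> :: real
  assumes "0 < \<alpha>" and "\<alpha> < 1"
  shows "(\<forall>A>0. \<forall>\<delta>>0. \<exists>A'>0. \<exists>\<delta>'>0. \<forall>f \<in> C1_0_plus. \<forall>x.
            loc_Hol_log_deriv \<alpha> x \<delta> A f \<longrightarrow> f \<in> LocHolObs \<alpha> x \<delta>' A')
       \<and> (\<forall>A'>0. \<forall>\<delta>'>0. \<exists>A''>0. \<exists>\<delta>''>0. \<forall>f \<in> C1_0_plus. \<forall>x.
            f \<in> LocHolObs \<alpha> x \<delta>' A' \<longrightarrow> loc_Hol_log_deriv \<alpha> x \<delta>'' A'' f)"
proof (intro conjI allI impI)
  fix A \<delta> :: real assume pos: "A > 0" "\<delta> > 0"
  show "\<exists>A'>0. \<exists>\<delta>'>0. \<forall>f \<in> C1_0_plus. \<forall>x.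
          loc_Hol_log_deriv \<alpha> x \<delta> A f \<longrightarrow> f \<in> LocHolObs \<alpha> x \<delta>' A'"
  proof (intro exI conjI ballI allI impI)
    show "A * exp (A * (2 * \<delta>) powr \<alpha>) > 0" using pos by simp
    show "\<delta> > 0" by fact
    show "f \<in> LocHolObs \<alpha> x \<delta> (A * exp (A * (2 * \<delta>) powr \<alpha>))"
      if "f \<in> C1_0_plus" "loc_Hol_log_deriv \<alpha> x \<delta> A f" for f x
      using LocHolObs_of_loc_Hol_log_deriv that assms pos by simp
  qed
next
  fix A \<delta> :: real assume pos: "A > 0" "\<delta> > 0"
  \<comment> \<open>The second entry is the radius at which \<open>A * (2 * \<rho>) powr \<alpha>\<close> equals \<open>1 / 2\<close>.\<close>
  define \<rho> where "\<rho> = min \<delta> ((1 / (2 * A)) powr (1 / \<alpha>) / 2)"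
  have \<rho>: "0 < \<rho>" "\<rho> \<le> \<delta>" "2 * \<rho> \<le> (1 / (2 * A)) powr (1 / \<alpha>)"
    using pos by (auto simp: \<rho>_def)
  have "(2 * \<rho>) powr \<alpha> \<le> ((1 / (2 * A)) powr (1 / \<alpha>)) powr \<alpha>"
    using \<rho> assms by (intro powr_mono2) auto
  also have "\<dots> = 1 / (2 * A)"
    using pos assms by (simp add: powr_powr)
  finally have small: "A * (2 * \<rho>) powr \<alpha> \<le> 1 / 2"
    using pos by (simp add: field_simps)
  define B where "B = 12 * (12 / (\<rho> / 3) powr \<alpha> + 168 * A * 2 powr \<alpha> / (1 - 2 powr (\<alpha> - 1)))"
  have "2 powr (\<alpha> - 1) < (1 :: real)"
    using assms powr_less_mono[of "\<alpha> - 1" 0 2] by simp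
  then have "0 < 12 / (\<rho> / 3) powr \<alpha>" "0 < 168 * A * 2 powr \<alpha> / (1 - 2 powr (\<alpha> - 1))"
    using pos \<rho>(1) by auto
  then have "B > 0"
    unfolding B_def by (intro mult_pos_pos add_pos_pos) auto
  show "\<exists>A''>0. \<exists>\<delta>''>0. \<forall>f \<in> C1_0_plus. \<forall>x.
          f \<in> LocHolObs \<alpha> x \<delta> A \<longrightarrow> loc_Hol_log_deriv \<alpha> x \<delta>'' A'' f"
  proof (intro exI conjI ballI allI impI)
    show "B > 0" by fact
    show "\<rho> / 3 > 0" using \<rho>(1) by simp
    show "loc_Hol_log_deriv \<alpha> x (\<rho> / 3) B f" if "f \<in> LocHolObs \<alpha> x \<delta> A" for f x
      unfolding B_def
      using loc_Hol_log_deriv_of_LocHolObs[OF LocHolObs_mono_radius[OF \<rho>(2) that]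
          assms pos(1) \<rho>(1) small] .
  qed
qed

end
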